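(* Let $(R,M)$ be a finite chain ring with Loewy length $n$. Then, for every integer $k\ge 2$, $$\zeta_k(R)=1-\frac{\displaystyle\sum_{t=0}^{n-1}\ \sum_{j=0}^{\left\lfloor\frac{t}{n+1}\right\rfloor}(-1)^j\binom{k}{j}\binom{t-j(n+1)+k-1}{k-1}}{(n+1)^k}.$$
   Context: A finite chain ring $(R,M)$ is a finite (nonzero) commutative ring with identity whose ideals are linearly ordered by inclusion; $M$ denotes its unique maximal ideal. Its Loewy length is the smallest positive integer $n$ with $M^n=(0)$, so that $R=M^0\supsetneq M\supsetneq\cdots\supsetneq M^{n-1}\supsetneq M^n=(0)$. For a finite commutative ring $R$, let $\mathcal I(R)$ denote the set of all ideals of $R$. For an integer $k\ge 2$, the ideal zero-product probability is $$\zeta_k(R)=\frac{|\{(I_1,\ldots,I_k)\in\mathcal I(R)^k : I_1I_2\cdots I_k=(0)\}|}{|\mathcal I(R)|^k},$$ where $I_1\cdots I_k$ is the usual product of ideals. Convention: $\binom{m}{r}=0$ whenever $m<r$ or $m<0$. *)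

theory Defs
  imports Complex_Main "HOL-Algebra.Ideal_Product"
begin

locale finite_chain_ring = cring R + maximalideal M R for R (structure) and M +
  assumes finite_carrier: "finite (carrier R)"
    and one_neq_zero: "\<one> \<noteq> \<zero>"
    and ideals_linear: "\<lbrakk>ideal I R; ideal J R\<rbrakk> \<Longrightarrow> I \<subseteq> J \<or> J \<subseteq> I"

text \<open>The structure \<^term>\<open>ideals_set R\<close> has the ideals of \<^term>\<open>R\<close> as its carrier, the product of
  ideals as its multiplication and the unit ideal \<^term>\<open>carrier R\<close> as its one, so powers taken in it
  are powers of ideals, with \<open>M\<^sup>0 = R\<close>.\<close>

definition loewy_length :: "('a, 'b) ring_scheme \<Rightarrow> 'a set \<Rightarrow> nat" where
  "loewy_length R M = (LEAST n. 0 < n \<and> M [^]\<^bsub>ideals_set R\<^esub> n = {\<zero>\<^bsub>R\<^esub>})"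

definition ideal_list_prod :: "('a, 'b) ring_scheme \<Rightarrow> 'a set list \<Rightarrow> 'a set" where
  "ideal_list_prod R Is = foldr (ideal_prod R) Is (carrier R)"

text \<open>A \<open>k\<close>-tuple of ideals is a list of length \<open>k\<close>.\<close>

definition ideal_zero_product_probability :: "nat \<Rightarrow> ('a, 'b) ring_scheme \<Rightarrow> real" where
  "ideal_zero_product_probability k R =
     real (card {Is. length Is = k \<and> set Is \<subseteq> {I. ideal I R} \<and> ideal_list_prod R Is = {\<zero>\<^bsub>R\<^esub>}})
       / real (card {I. ideal I R}) ^ k"

end

theory Submission
  imports Defs
begin

text \<open>Every ideal of a finite chain ring is principal; if \<open>p\<close> generates \<open>M\<close>, then \<open>p\<close> is nilpotent and
  each element is a unit times a power of \<open>p\<close>. Hence the ideals are exactly the \<open>n + 1\<close> distinct powers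
  \<open>M\<^sup>0, \<dots>, M\<^sup>n\<close>, and a product of such powers vanishes iff the exponents add up to at least \<open>n\<close>. The
  exponent tuples with sum \<open>t < n\<close> automatically have all entries at most \<open>n\<close>, so stars and bars
  counts them; likewise \<open>t div (n + 1) = 0\<close>, so only \<open>j = 0\<close> contributes to the inner sum.\<close>

context finite_chain_ring
begin

abbreviation ideal_power :: "nat \<Rightarrow> 'a set" where
  "ideal_power i \<equiv> M [^]\<^bsub>ideals_set R\<^esub> i"

section \<open>Principal ideals and units\<close>

text \<open>By finiteness, some principal ideal is maximal among those generated by elements of
  \<open>I\<close>. Linearity makes it contain all the others, hence every element of
  \<open>I\<close>.\<close>

lemma ideal_is_principal:
  assumes I: "ideal I R"
  shows "\<exists>a\<in>I. I = PIdl a"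
proof -
  have sub: "I \<subseteq> carrier R"
    using I by (simp add: additive_subgroup.a_subset ideal.axioms(1))
  let ?A = "(\<lambda>x. PIdl x) ` I"
  have "finite ?A"
    using finite_subset[OF sub finite_carrier] by simp
  moreover have "?A \<noteq> {}"
    using additive_subgroup.zero_closed[OF ideal.axioms(1)[OF I]] by blast
  ultimately obtain P where P: "P \<in> ?A" "\<forall>Q\<in>?A. P \<subseteq> Q \<longrightarrow> P = Q"
    using finite_has_maximal by metis
  then obtain a where a: "a \<in> I" "P = PIdl a" by blast
  have "y \<in> PIdl a" if y: "y \<in> I" for y
  proof -
    have "PIdl y \<subseteq> PIdl a \<or> PIdl a \<subseteq> PIdl y"
      using ideals_linear cgenideal_ideal sub y a(1) by blast
    hence "PIdl y \<subseteq> PIdl a"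
      using P(2) a(2) y by blast
    thus ?thesis
      using cgenideal_self sub y by blast
  qed
  moreover have "PIdl a \<subseteq> I"
    using cgenideal_minimal[OF I a(1)] .
  ultimately show ?thesis
    using a(1) by blast
qed

text \<open>Comparability forces \<open>PIdl u\<close> to contain \<open>M\<close> strictly, so by
  maximality it is the whole ring and contains \<open>\<one>\<close>.\<close>

lemma left_inverse_if_not_in_M:
  assumes u: "u \<in> carrier R" "u \<notin> M"
  shows "\<exists>v\<in>carrier R. v \<otimes> u = \<one>"
proof -
  have id: "ideal (PIdl u) R" using cgenideal_ideal u(1) .
  have "u \<in> PIdl u" using cgenideal_self u(1) .
  hence "M \<subseteq> PIdl u" "PIdl u \<noteq> M"
    using ideals_linear[OF id is_ideal] u(2) by blast+
  moreover have "PIdl u \<subseteq> carrier R"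
    using id by (simp add: additive_subgroup.a_subset ideal.axioms(1))
  ultimately have "PIdl u = carrier R"
    using I_maximal[OF id] by blast
  hence "\<one> \<in> PIdl u" by simp
  then obtain v where "v \<in> carrier R" "\<one> = v \<otimes> u"
    unfolding cgenideal_def by blast
  thus ?thesis by metis
qed

text \<open>Nakayama's lemma for a single element.\<close>

lemma eq_zero_if_fixed_by_M:
  assumes x: "x \<in> carrier R" and m: "m \<in> M" and eq: "x = m \<otimes> x"
  shows "x = \<zero>"
proof -
  have mc: "m \<in> carrier R" using m Icarr by blast
  \<comment> \<open>Thus \<open>\<one> \<ominus> m\<close> has an inverse \<open>v\<close>; since it
    also annihilates \<open>x\<close>, multiplying by \<open>v\<close> gives
    \<open>x = \<zero>\<close>.\<close>
  have "\<one> \<ominus> m \<notin> M"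
  proof
    assume "\<one> \<ominus> m \<in> M"
    hence "(\<one> \<ominus> m) \<oplus> m \<in> M" using m a_closed by blast
    moreover have "(\<one> \<ominus> m) \<oplus> m = \<one>" using mc by algebra
    ultimately have "\<one> \<in> M" by simp
    thus False using one_imp_carrier I_notcarr by simp
  qed
  then obtain v where v: "v \<in> carrier R" "v \<otimes> (\<one> \<ominus> m) = \<one>"
    using left_inverse_if_not_in_M mc by (metis minus_closed one_closed)
  have "x = v \<otimes> (\<one> \<ominus> m) \<otimes> x" using v x by simp
  also have "\<dots> = v \<otimes> (x \<ominus> m \<otimes> x)" using v(1) x mc by algebra
  also have "\<dots> = \<zero>" using eq[symmetric] v(1) x by (simp add: r_neg minus_eq)
  finally show ?thesis .
qed

lemma cgenideal_mult:
  assumes a: "a \<in> carrier R" and b: "b \<in> carrier R"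
  shows "(PIdl a) \<cdot> (PIdl b) = PIdl (a \<otimes> b)"
proof -
  have "(PIdl a) \<cdot> (PIdl b) = Idl (PIdl (a \<otimes> b))"
    using ideal_prod_eq_genideal cgenideal_ideal cgenideal_prod a b by simp
  also have "\<dots> = PIdl (a \<otimes> b)"
    by (simp add: a b cgenideal_ideal genideal_self subset_antisym genideal_minimal
        additive_subgroup.a_subset ideal.axioms(1))
  finally show ?thesis .
qed

section \<open>Powers of the maximal ideal\<close>

lemma M_in_ideals_set: "M \<in> carrier (ideals_set R)"
  using is_ideal by (simp add: ideals_set_def)

lemma monoid_ideals_set: "monoid (ideals_set R)"
  using ideals_set_is_comm_monoid comm_monoid.axioms(1) by blast

lemma ideal_ideal_power: "ideal (ideal_power i) R"
  using monoid.nat_pow_closed[OF monoid_ideals_set M_in_ideals_set, of i]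
  by (simp add: ideals_set_def)

lemma one_ideals_set: "\<one>\<^bsub>ideals_set R\<^esub> = carrier R"
  by (simp add: ideals_set_def)

lemma ideal_power_0: "ideal_power 0 = carrier R"
  by (simp add: one_ideals_set nat_pow_def)

lemma ideal_power_add: "ideal_power i \<cdot> ideal_power j = ideal_power (i + j)"
  using monoid.nat_pow_mult[OF monoid_ideals_set M_in_ideals_set, of i j]
  by (simp add: ideals_set_def)

lemma ideal_power_cgenideal:
  assumes p: "p \<in> carrier R" "M = PIdl p"
  shows "ideal_power i = PIdl (p [^] i)"
proof (induction i)
  case 0
  have "PIdl \<one> = carrier R" unfolding cgenideal_def by force
  thus ?case by (simp add: one_ideals_set)
next
  case (Suc i)
  have "ideal_power (Suc i) = ideal_power i \<cdot> M"
    using monoid.nat_pow_Suc[OF monoid_ideals_set, of M i] by (simp add: ideals_set_def)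
  also have "\<dots> = (PIdl (p [^] i)) \<cdot> (PIdl p)"
    using Suc p(2) by simp
  finally show ?case
    using cgenideal_mult p(1) by simp
qed

lemma generator_power_in_M:
  assumes p: "p \<in> carrier R" "M = PIdl p" and "0 < i"
  shows "p [^] (i::nat) \<in> M"
proof -
  obtain d where d: "i = Suc d" using \<open>0 < i\<close> gr0_implies_Suc by blast
  have "p \<in> M" using p cgenideal_self by simp
  thus ?thesis using d I_l_closed p(1) by simp
qed

text \<open>The powers of \<open>M\<close> can only repeat at zero: equality makes
  \<open>p [^] i\<close> a multiple of \<open>p [^] j\<close>, hence fixed by a factor that lies in
  \<open>M\<close> because \<open>j - i > 0\<close>, and Nakayama applies.\<close>

lemma ideal_power_eq_zero_if_eq:
  assumes eq: "ideal_power i = ideal_power j" and "i < j"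
  shows "ideal_power i = {\<zero>}"
proof -
  obtain p where p: "p \<in> carrier R" "M = PIdl p"
    using ideal_is_principal[OF is_ideal] Icarr by blast
  have "p [^] i \<in> PIdl (p [^] j)"
    using eq ideal_power_cgenideal[OF p] cgenideal_self p(1) by (metis nat_pow_closed)
  then obtain r where r: "r \<in> carrier R" "p [^] i = r \<otimes> p [^] j"
    unfolding cgenideal_def by blast
  have "p [^] j = p [^] (j - i) \<otimes> p [^] i"
    using nat_pow_mult[OF p(1), of "j - i" i] \<open>i < j\<close> by simp
  hence "p [^] i = (r \<otimes> p [^] (j - i)) \<otimes> p [^] i"
    using r p(1) by (simp add: m_assoc)
  moreover have "r \<otimes> p [^] (j - i) \<in> M"
    using I_l_closed generator_power_in_M[OF p] r(1) \<open>i < j\<close> by simp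
  ultimately have "p [^] i = \<zero>"
    using eq_zero_if_fixed_by_M p(1) nat_pow_closed by blast
  thus ?thesis
    using ideal_power_cgenideal[OF p] by (force simp: cgenideal_def)
qed

text \<open>Pigeonhole: the powers are subsets of a finite carrier, so two of them coincide. This
  shows that the Loewy length is well defined.\<close>

lemma ideal_power_nilpotent: "\<exists>i>0. ideal_power i = {\<zero>}"
proof -
  have "range ideal_power \<subseteq> Pow (carrier R)"
    using ideal_ideal_power by (auto dest: ideal.Icarr)
  hence "finite (range ideal_power)"
    using finite_carrier finite_subset by blast
  hence "\<not> inj ideal_power"
    using finite_imageD infinite_UNIV_nat by blast
  then obtain i j where "i < j" and eq: "ideal_power i = ideal_power j"
    unfolding inj_def by (metis nat_neq_iff)
  \<comment> \<open>The larger exponent is taken because it is certainly positive.\<close>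
  hence "ideal_power j = {\<zero>}"
    using ideal_power_eq_zero_if_eq by blast
  thus ?thesis using \<open>i < j\<close> by (metis gr_zeroI not_less_zero)
qed

lemma loewy_length_pos: "0 < loewy_length R M"
  and ideal_power_loewy_length: "ideal_power (loewy_length R M) = {\<zero>}"
  using LeastI_ex[OF ideal_power_nilpotent] unfolding loewy_length_def by blast+

lemma ideal_power_eq_zero_iff: "ideal_power i = {\<zero>} \<longleftrightarrow> loewy_length R M \<le> i"
proof
  assume zero: "ideal_power i = {\<zero>}"
  \<comment> \<open>The Loewy length is the least positive exponent, so exponent 0 has to be
    excluded; this is where the ring being nonzero enters.\<close>
  have "i \<noteq> 0"
    using zero one_neq_zero ideal_power_0 by (metis one_closed singletonD)
  thus "loewy_length R M \<le> i"
    using zero unfolding loewy_length_def by (intro Least_le) simp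
next
  assume "loewy_length R M \<le> i"
  then obtain d where "i = d + loewy_length R M"
    by (metis le_add_diff_inverse2)
  thus "ideal_power i = {\<zero>}"
    using ideal_power_add[of d "loewy_length R M"] ideal_power_loewy_length
      ideal_prod_zero ideal_ideal_power by simp
qed

section \<open>Classification of the ideals\<close>

text \<open>Take the last power \<open>M\<^sup>i\<close> containing a generator \<open>a\<close> of
  \<open>I\<close>. Then \<open>a = u \<otimes> p [^] i\<close> with \<open>u\<close> outside
  \<open>M\<close>, as otherwise \<open>a\<close> would lie in the next power. So \<open>u\<close>
  is a unit, and \<open>a\<close> and \<open>p [^] i\<close> generate the same ideal.\<close>

lemma ideal_eq_ideal_power:
  assumes I: "ideal I R"
  shows "\<exists>i\<le>loewy_length R M. I = ideal_power i"
proof (cases "I = {\<zero>}")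
  case True
  thus ?thesis using ideal_power_loewy_length by blast
next
  case False
  obtain p where p: "p \<in> carrier R" "M = PIdl p"
    using ideal_is_principal[OF is_ideal] Icarr by blast
  obtain a where a: "a \<in> I" "I = PIdl a"
    using ideal_is_principal[OF I] by blast
  have ac: "a \<in> carrier R" using I a(1) ideal.Icarr by metis
  have "a \<noteq> \<zero>"
    using False a(2) by (force simp: cgenideal_def)
  hence "a \<notin> ideal_power (loewy_length R M)"
    using ideal_power_loewy_length by simp
  moreover have "a \<in> ideal_power 0"
    using ac ideal_power_0 by simp
  \<comment> \<open>Induction read contrapositively: membership holds at 0 and fails at the Loewy
    length, so it is lost at some successor.\<close>
  ultimately obtain i where i: "a \<in> ideal_power i" "a \<notin> ideal_power (Suc i)"
    using nat_induct[of "\<lambda>i. a \<in> ideal_power i"] by blast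
  obtain u where u: "u \<in> carrier R" "a = u \<otimes> p [^] i"
    using i(1) ideal_power_cgenideal[OF p] by (auto simp: cgenideal_def)
  have "u \<notin> M"
  proof
    assume "u \<in> M"
    then obtain w where w: "w \<in> carrier R" "u = w \<otimes> p"
      unfolding p(2) cgenideal_def by blast
    have "a = w \<otimes> p [^] Suc i"
      using u w p(1) by (simp add: m_assoc m_comm m_lcomm)
    hence "a \<in> PIdl (p [^] Suc i)"
      using w(1) unfolding cgenideal_def by blast
    thus False
      using i(2) unfolding ideal_power_cgenideal[OF p] by blast
  qed
  then obtain v where v: "v \<in> carrier R" "v \<otimes> u = \<one>"
    using left_inverse_if_not_in_M u(1) by blast
  have "p [^] i = v \<otimes> a"
    using u v p(1) m_assoc[of v u "p [^] i"] by simp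
  hence "p [^] i \<in> I"
    using ideal.I_l_closed[OF I a(1) v(1)] by simp
  hence "ideal_power i \<subseteq> I"
    using cgenideal_minimal[OF I] ideal_power_cgenideal[OF p] by simp
  moreover have "I \<subseteq> ideal_power i"
    using cgenideal_minimal[OF ideal_ideal_power i(1)] a(2) by simp
  ultimately have eq: "I = ideal_power i" by blast
  hence "i \<le> loewy_length R M"
    using False ideal_power_eq_zero_iff[of i] by auto
  thus ?thesis using eq by blast
qed

lemma bij_betw_ideal_power:
  "bij_betw ideal_power {0..loewy_length R M} {I. ideal I R}"
proof (rule bij_betw_imageI)
  \<comment> \<open>A repetition would make \<open>ideal_power i\<close> zero with \<open>i\<close>
    below the Loewy length.\<close>
  have False if "i < j" "j \<le> loewy_length R M" "ideal_power i = ideal_power j" for i j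
    using that ideal_power_eq_zero_if_eq[of i j] ideal_power_eq_zero_iff[of i] by simp
  thus "inj_on ideal_power {0..loewy_length R M}"
    by (intro inj_onI) (metis atLeastAtMost_iff nat_neq_iff)
  show "ideal_power ` {0..loewy_length R M} = {I. ideal I R}"
    using ideal_eq_ideal_power ideal_ideal_power by fastforce
qed

lemma ideal_list_prod_ideal_powers:
  "ideal_list_prod R (map ideal_power es) = ideal_power (sum_list es)"
  unfolding ideal_list_prod_def
  by (induction es) (simp_all add: one_ideals_set ideal_power_add)

text \<open>Applying the bijection between exponents and ideals entrywise turns the count of tuples
  of ideals into a count of tuples of exponents.\<close>

lemma card_zero_product_tuples:
  "card {Is. length Is = k \<and> set Is \<subseteq> {I. ideal I R} \<and> ideal_list_prod R Is = {\<zero>}} =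
   card {es. length es = k \<and> set es \<subseteq> {0..loewy_length R M} \<and> loewy_length R M \<le> sum_list es}"
  (is "card ?Z = card ?E")
proof -
  let ?n = "loewy_length R M"
  have image: "map ideal_power ` ?E = ?Z"
  proof (intro equalityI subsetI)
    fix Is assume "Is \<in> map ideal_power ` ?E"
    then obtain es where "es \<in> ?E" "Is = map ideal_power es"
      by blast
    thus "Is \<in> ?Z"
      by (simp add: image_subset_iff ideal_ideal_power ideal_list_prod_ideal_powers
          ideal_power_eq_zero_iff)
  next
    fix Is assume Is: "Is \<in> ?Z"
    have "Is \<in> lists (ideal_power ` {0..?n})"
      using Is bij_betw_imp_surj_on[OF bij_betw_ideal_power] by auto
    then obtain es where es: "set es \<subseteq> {0..?n}" "Is = map ideal_power es"
      unfolding lists_image by auto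
    thus "Is \<in> map ideal_power ` ?E"
      using Is by (auto simp: ideal_list_prod_ideal_powers ideal_power_eq_zero_iff)
  qed
  have inj: "inj_on (map ideal_power) ?E"
  proof (rule inj_on_subset)
    show "inj_on (map ideal_power) (lists {0..?n})"
      using bij_betw_ideal_power by (intro inj_on_map_lists) (auto simp: bij_betw_def)
  qed auto
  show ?thesis using card_image[OF inj] unfolding image .
qed

end

section \<open>Counting exponent tuples\<close>

lemma card_lists_sum_list_less:
  assumes "k \<ge> 1"
  shows "card {es :: nat list. length es = k \<and> sum_list es < n} =
    (\<Sum>t<n. (t + k - 1) choose (k - 1))"
proof -
  let ?L = "\<lambda>t. {es :: nat list. length es = k \<and> sum_list es = t}"
  have fin: "finite (?L t)" for t
  proof (rule finite_subset)
    show "?L t \<subseteq> {es. set es \<subseteq> {0..t} \<and> length es = k}"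
      using member_le_sum_list by fastforce
  qed (simp add: finite_lists_length_eq)
  have "{es :: nat list. length es = k \<and> sum_list es < n} = (\<Union>t<n. ?L t)"
    by auto
  also have "card \<dots> = (\<Sum>t<n. card (?L t))"
    using fin by (intro card_UN_disjoint) auto
  also have "\<dots> = (\<Sum>t<n. (t + k - 1) choose (k - 1))"
  proof (rule sum.cong[OF refl])
    fix t
    \<comment> \<open>Stars and bars in \<open>card_length_sum_list\<close> has lower index
      \<open>t\<close>. Passing to \<open>k - 1\<close> needs \<open>t \<le> t + k - 1\<close>, that
      is \<open>k \<ge> 1\<close>.\<close>
    have "(t + k - 1) choose t = (t + k - 1) choose (k - 1)"
      using binomial_symmetric[of t "t + k - 1"] assms by simp
    thus "card (?L t) = (t + k - 1) choose (k - 1)"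
      by (simp add: card_length_sum_list)
  qed
  finally show ?thesis .
qed

text \<open>The tuples of sum below \<open>n\<close> are the complement in the box of all tuples
  with entries up to \<open>n\<close>. The additive form avoids truncated subtraction.\<close>

lemma card_bounded_lists_sum_list_ge:
  assumes "k \<ge> 1"
  shows "card {es :: nat list. length es = k \<and> set es \<subseteq> {0..n} \<and> n \<le> sum_list es} +
    (\<Sum>t<n. (t + k - 1) choose (k - 1)) = (n + 1) ^ k"
proof -
  let ?E = "{es :: nat list. length es = k \<and> set es \<subseteq> {0..n} \<and> n \<le> sum_list es}"
  let ?S = "{es :: nat list. length es = k \<and> sum_list es < n}"
  let ?A = "{es :: nat list. set es \<subseteq> {0..n} \<and> length es = k}"
  have "?S \<subseteq> ?A"
    using member_le_sum_list by fastforce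
  hence un: "?E \<union> ?S = ?A"
    by auto
  have "finite (?E \<union> ?S)"
    unfolding un by (simp add: finite_lists_length_eq)
  hence "finite ?E" "finite ?S"
    unfolding finite_Un by blast+
  hence "card ?E + card ?S = card ?A"
    unfolding un[symmetric] by (intro card_Un_disjoint[symmetric]) auto
  thus ?thesis
    using card_lists_sum_list_less[OF assms] by (simp add: card_lists_length_eq)
qed

theorem theorem5p3:
  fixes R :: "('a, 'b) ring_scheme" and M :: "'a set" and n k :: nat
  assumes "finite_chain_ring R M"
    and "n = loewy_length R M"
    and "k \<ge> 2"
  shows "ideal_zero_product_probability k R =
    1 - (\<Sum>t = 0..n - 1. \<Sum>j = 0..t div (n + 1).
           (-1) ^ j * real (k choose j) * real ((t - j * (n + 1) + k - 1) choose (k - 1)))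
        / real (n + 1) ^ k"
proof -
  interpret finite_chain_ring R M by fact
  let ?E = "{es :: nat list. length es = k \<and> set es \<subseteq> {0..n} \<and> n \<le> sum_list es}"
  let ?S = "\<Sum>t<n. (t + k - 1) choose (k - 1)"
  have "0 < n" using loewy_length_pos assms(2) by simp
  \<comment> \<open>Positivity of \<open>n\<close> matters: for \<open>n = 0\<close> truncated
    subtraction would leave the index 0 in the left-hand range.\<close>
  hence range: "{0..n - 1} = {..<n}" by auto
  have sum: "(\<Sum>t = 0..n - 1. \<Sum>j = 0..t div (n + 1).
           (-1) ^ j * real (k choose j) * real ((t - j * (n + 1) + k - 1) choose (k - 1))) = real ?S"
    unfolding range of_nat_sum by (intro sum.cong) auto
  have ideals: "card {I. ideal I R} = n + 1"
    using bij_betw_same_card[OF bij_betw_ideal_power] assms(2) by simp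
  have "card ?E + ?S = (n + 1) ^ k"
    using card_bounded_lists_sum_list_ge assms(3) by simp
  hence "real (card ?E) = real (n + 1) ^ k - real ?S"
    unfolding of_nat_power[symmetric] by linarith
  hence "ideal_zero_product_probability k R = (real (n + 1) ^ k - real ?S) / real (n + 1) ^ k"
    unfolding ideal_zero_product_probability_def card_zero_product_tuples ideals
    by (simp add: assms(2))
  also have "\<dots> = 1 - real ?S / real (n + 1) ^ k"
    by (simp add: diff_divide_distrib)
  finally show ?thesis unfolding sum .
qed

end
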